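(* Let $(X,\le)$ be an ordered vector space, $C\subseteq X$, and let $\{T_t\}_{t\ge0}$ be a family of mappings $T_t:C\to C$ such that (i) for all $u_0,\hat u_0\in C$ with $u_0\le\hat u_0$, one has $T_tu_0\le T_t\hat u_0$ for all $t\ge0$; (ii) $\lambda^{-1}T_{\lambda t}u_0=T_t[\lambda^{-1}u_0]$ for all $\lambda>0$, $t\ge0$ and $u_0\in C$. Then for every $u_0\in C$ satisfying $u_0\ge0$, $$\frac{T_{t+h}u_0-T_tu_0}{h}\le\frac1t\,T_tu_0\qquad\text{for every }t,h>0.$$
   Context: An ordered vector space is a real vector space with a partial order compatible with addition and with multiplication by nonnegative scalars. Implicitly in hypothesis (ii), $\lambda^{-1}u_0\in C$ for all $u_0\in C$, $\lambda>0$. *)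

theory Defs
  imports Complex_Main
begin

end

theory Submission
  imports Defs
begin

text \<open>Homogeneity turns a change of time into a change of initial datum: with
  \<open>lam = (t + h) / t\<close>, the value \<open>T (t + h) u\<close> is \<open>lam\<close> times
  \<open>T t\<close> applied to \<open>u\<close> scaled by \<open>inverse lam\<close>. As
  \<open>lam\<close> exceeds 1 and \<open>u\<close> is nonnegative, the scaled datum lies below
  \<open>u\<close>, so monotonicity gives \<open>T (t + h) u\<close> \<le> \<open>lam\<close> times
  \<open>T t u\<close>. Subtracting \<open>T t u\<close> and dividing by \<open>h\<close> leaves the
  factor \<open>(lam - 1) / h = 1 / t\<close>.\<close>

theorem theorem2p7:
  fixes C :: "'a::ordered_real_vector set"
    and T :: "real \<Rightarrow> 'a \<Rightarrow> 'a"
  assumes T_into: "\<And>t u. t \<ge> 0 \<Longrightarrow> u \<in> C \<Longrightarrow> T t u \<in> C"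
    and C_scale: "\<And>lam u. lam > 0 \<Longrightarrow> u \<in> C \<Longrightarrow> inverse lam *\<^sub>R u \<in> C"
    and T_mono: "\<And>u v t. u \<in> C \<Longrightarrow> v \<in> C \<Longrightarrow> u \<le> v \<Longrightarrow> t \<ge> 0 \<Longrightarrow> T t u \<le> T t v"
    and T_homog: "\<And>lam t u. lam > 0 \<Longrightarrow> t \<ge> 0 \<Longrightarrow> u \<in> C \<Longrightarrow>
      inverse lam *\<^sub>R T (lam * t) u = T t (inverse lam *\<^sub>R u)"
  shows "\<forall>u\<in>C. u \<ge> 0 \<longrightarrow> (\<forall>t>0. \<forall>h>0.
    (T (t + h) u - T t u) /\<^sub>R h \<le> (1 / t) *\<^sub>R T t u)"
proof (intro ballI impI allI)
  fix u :: 'a and t h :: real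
  assume u: "u \<in> C" "u \<ge> 0" and t: "t > 0" and h: "h > 0"
  define lam where "lam = (t + h) / t"
  have lam: "lam > 0" "inverse lam \<le> 1" "lam * t = t + h" "lam - 1 = h * (1 / t)"
    using t h by (auto simp: lam_def field_simps)
  \<comment> \<open>Positivity of \<open>u\<close> enters here. The factor 1 is kept explicit so
    that \<open>scaleR_right_mono\<close> applies directly.\<close>
  have "inverse lam *\<^sub>R u \<le> 1 *\<^sub>R u"
    using lam(2) u(2) by (rule scaleR_right_mono)
  then have "T t (inverse lam *\<^sub>R u) \<le> T t u"
    using T_mono C_scale lam(1) u(1) t by simp
  \<comment> \<open>Homogeneity read from right to left, with
    \<open>lam * t = t + h\<close>.\<close>
  then have "inverse lam *\<^sub>R T (t + h) u \<le> T t u"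
    using T_homog[OF lam(1) _ u(1), of t] t lam(3) by simp
  then have "lam *\<^sub>R (inverse lam *\<^sub>R T (t + h) u) \<le> lam *\<^sub>R T t u"
    using lam(1) by (intro scaleR_left_mono) simp_all
  then have "T (t + h) u - T t u \<le> (lam - 1) *\<^sub>R T t u"
    using lam(1) by (simp add: scaleR_left_diff_distrib)
  then have "(T (t + h) u - T t u) /\<^sub>R h \<le> ((lam - 1) *\<^sub>R T t u) /\<^sub>R h"
    using h by (intro scaleR_left_mono) simp_all
  \<comment> \<open>The form \<open>h * (1 / t)\<close> of \<open>lam - 1\<close> lets
    \<open>h\<close> cancel.\<close>
  also have "\<dots> = (1 / t) *\<^sub>R T t u"
    unfolding lam(4) using h by simp
  finally show "(T (t + h) u - T t u) /\<^sub>R h \<le> (1 / t) *\<^sub>R T t u" .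
qed

end
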